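(* Let $n\ge 4$ be even. Every $\frac{n-2}{2}$-$(n,\frac n2,1)$ design $\mathbb{D}=(\mathcal{P},\mathcal{B})$ is self-complementary, i.e., for every block $B\in\mathcal{B}$ the complement $\mathcal{P}\setminus B$ is also a block in $\mathcal{B}$; equivalently, $\overline{\mathbb{D}}=\mathbb{D}$.
   Context: A $t$-$(n,k,\lambda)$ design, $1\le t\le k\le n$, is a pair $(\mathcal{P},\mathcal{B})$ where $\mathcal{P}$ is a set of $n$ points and $\mathcal{B}$ is a set of $k$-subsets (blocks) of $\mathcal{P}$ such that every $t$-subset of $\mathcal{P}$ is contained in exactly $\lambda$ blocks. The complementary design of $\mathbb{D}=(\mathcal{P},\mathcal{B})$ is $\overline{\mathbb{D}}=(\mathcal{P},\overline{\mathcal{B}})$ with $\overline{\mathcal{B}}=\{\mathcal{P}\setminus B: B\in\mathcal{B}\}$. *)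

theory Defs
  imports Main
begin

text \<open>A design is a pair of a point set and a set of blocks; blocks form a set, so there are
  no repeated blocks.\<close>

definition t_design :: "nat \<Rightarrow> nat \<Rightarrow> nat \<Rightarrow> nat \<Rightarrow> 'a set \<times> 'a set set \<Rightarrow> bool" where
  "t_design t n k l D \<longleftrightarrow>
     (case D of (P, Bs) \<Rightarrow>
        1 \<le> t \<and> t \<le> k \<and> k \<le> n \<and>
        finite P \<and> card P = n \<and>
        (\<forall>B\<in>Bs. B \<subseteq> P \<and> card B = k) \<and>
        (\<forall>T. T \<subseteq> P \<and> card T = t \<longrightarrow> card {B \<in> Bs. T \<subseteq> B} = l))"

definition complementary_design :: "'a set \<times> 'a set set \<Rightarrow> 'a set \<times> 'a set set" where
  "complementary_design D = (case D of (P, Bs) \<Rightarrow> (P, {P - B | B. B \<in> Bs}))"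

end

theory Submission imports Defs Complex_Main begin

text \<open>
  Put \<open>t = (n - 2) / 2\<close>, so that blocks have \<open>t + 1\<close> points and \<open>n = 2 (t + 1)\<close>, and fix a block
  \<open>B\<close>. The idea is to sum, over all \<open>t\<close>-subsets \<open>T\<close> of the points, a weight \<open>w i\<close> depending only
  on \<open>i = card (T \<inter> B)\<close>, namely \<open>w i = (-1)^i / (t choose i)\<close>, and to evaluate the sum twice.

  Every \<open>T\<close> lies in exactly one block, so the sum may be distributed over the blocks
  (\<open>sum_t_subsets_by_block\<close>). A block \<open>A\<close> that meets \<open>B\<close> in \<open>i\<close> points then contributes
  \<open>i * w (i - 1) + (t + 1 - i) * w i\<close>, and \<open>w\<close> is chosen so that this vanishes unless \<open>i\<close> is \<open>0\<close>
  or \<open>t + 1\<close> (\<open>alternating_weight_cancel\<close>), that is, unless \<open>A\<close> is the complement of \<open>B\<close> or \<open>B\<close>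
  itself.

  On the other hand, \<open>t\<close> is odd (a parity condition on the existence of the design,
  \<open>t_design_parity\<close>), so \<open>w (t - i) = - w i\<close>; exchanging \<open>B\<close> with its complement by a bijection
  therefore changes the sign of the whole sum, which must be \<open>0\<close>
  (\<open>sum_halving_antisymmetric\<close>). The block \<open>B\<close> contributes a nonzero amount, hence another
  contributing block is needed to cancel it, and the complement of \<open>B\<close> is the only candidate.
\<close>

section \<open>Two counting arguments for designs with one block through each t-set\<close>

lemma t_design_block:
  assumes "t_design t n k l (P, Bs)" and "B \<in> Bs"
  shows "B \<subseteq> P" "card B = k" "finite B"
  using assms by (auto simp: t_design_def intro: finite_subset)

lemma t_design_finite_points:
  assumes "t_design t n k l (P, Bs)"
  shows "finite P" "card P = n"
  using assms by (auto simp: t_design_def)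

lemma t_design_finite_blocks:
  assumes "t_design t n k l (P, Bs)"
  shows "finite Bs"
proof (rule finite_subset)
  show "Bs \<subseteq> Pow P"
    using t_design_block(1)[OF assms] by blast
  show "finite (Pow P)"
    using t_design_finite_points(1)[OF assms] by simp
qed

lemma t_design_unique_block:
  assumes "t_design t n k 1 (P, Bs)" and "T \<subseteq> P" and "card T = t"
  shows "\<exists>!A. A \<in> Bs \<and> T \<subseteq> A"
proof -
  have "card {A \<in> Bs. T \<subseteq> A} = 1"
    using assms by (auto simp: t_design_def)
  then obtain A where "{A \<in> Bs. T \<subseteq> A} = {A}"
    by (rule card_1_singletonE)
  then have "A' \<in> Bs \<and> T \<subseteq> A' \<longleftrightarrow> A' = A" for A'
    by (simp add: set_eq_iff)
  then show ?thesis by simp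
qed

text \<open>
  The blocks through a fixed set of \<open>t - 1\<close> points cut the other points into pairs, because any
  one further point determines the block.
\<close>

lemma t_design_parity:
  assumes D: "t_design t n (Suc t) 1 (P, Bs)"
  shows "even (Suc n - t)"
proof -
  have t: "1 \<le> t" "t \<le> n"
    using D by (auto simp: t_design_def)
  note P = t_design_finite_points[OF D]
  obtain S where S: "S \<subseteq> P" "card S = t - 1" "finite S"
  proof (rule obtain_subset_with_card_n)
    show "t - 1 \<le> card P"
      using t P by simp
  qed
  define \<C> where "\<C> = (\<lambda>A. A - S) ` {A \<in> Bs. S \<subseteq> A}"
  have single: "\<exists>!A. A \<in> Bs \<and> insert x S \<subseteq> A" if "x \<in> P - S" for x
    using that S t by (intro t_design_unique_block[OF D]) auto
  have union: "\<Union> \<C> = P - S"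
  proof (intro equalityI subsetI)
    show "x \<in> P - S" if "x \<in> \<Union> \<C>" for x
      using that t_design_block(1)[OF D] unfolding \<C>_def by auto
    show "x \<in> \<Union> \<C>" if x: "x \<in> P - S" for x
    proof -
      obtain A where "A \<in> Bs" "insert x S \<subseteq> A"
        using ex1_implies_ex[OF single[OF x]] by blast
      then show ?thesis
        using x unfolding \<C>_def by auto
    qed
  qed
  have "2 * card \<C> = card (\<Union> \<C>)"
  proof (rule card_partition)
    show "finite \<C>"
      using t_design_finite_blocks[OF D] unfolding \<C>_def by simp
    show "finite (\<Union> \<C>)"
      using P union by simp
    show "card c = 2" if "c \<in> \<C>" for c
      using that t_design_block[OF D] S t unfolding \<C>_def by (auto simp: card_Diff_subset)
    show "c1 \<inter> c2 = {}" if c: "c1 \<in> \<C>" "c2 \<in> \<C>" "c1 \<noteq> c2" for c1 c2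
    proof (rule ccontr)
      assume "c1 \<inter> c2 \<noteq> {}"
      then obtain x where x: "x \<in> c1" "x \<in> c2" by blast
      have "x \<in> P - S"
        using x(1) c(1) union by blast
      obtain A1 A2 where A: "A1 \<in> Bs" "S \<subseteq> A1" "c1 = A1 - S" "A2 \<in> Bs" "S \<subseteq> A2" "c2 = A2 - S"
        using c(1,2) unfolding \<C>_def by auto
      then have "A1 = A2"
        using x single[OF \<open>x \<in> P - S\<close>] by (metis Diff_iff insert_subset)
      then show False
        using A c(3) by simp
    qed
  qed
  also have "\<dots> = Suc n - t"
    using union S P t by (simp add: card_Diff_subset)
  finally show ?thesis
    using dvd_triv_left[of 2 "card \<C>"] by simp
qed

lemma sum_t_subsets_by_block:
  fixes f :: "'a set \<Rightarrow> 'b::comm_monoid_add"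
  assumes D: "t_design t n (Suc t) 1 (P, Bs)"
  shows "(\<Sum>T | T \<subseteq> P \<and> card T = t. f T) = (\<Sum>A\<in>Bs. \<Sum>a\<in>A. f (A - {a}))"
proof -
  let ?\<T> = "{T. T \<subseteq> P \<and> card T = t}"
  have fin: "finite ?\<T>"
    using t_design_finite_points(1)[OF D] by simp
  have "(\<Sum>T\<in>?\<T>. f T) = (\<Sum>T\<in>?\<T>. \<Sum>A | A \<in> Bs \<and> T \<subseteq> A. f T)"
  proof (rule sum.cong[OF refl])
    fix T assume "T \<in> ?\<T>"
    then have "card {A \<in> Bs. T \<subseteq> A} = 1"
      using D by (simp add: t_design_def)
    then obtain A where "{A \<in> Bs. T \<subseteq> A} = {A}"
      by (rule card_1_singletonE)
    then show "f T = (\<Sum>A | A \<in> Bs \<and> T \<subseteq> A. f T)" by simp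
  qed
  also have "\<dots> = (\<Sum>A\<in>Bs. \<Sum>T | T \<in> ?\<T> \<and> T \<subseteq> A. f T)"
    by (rule sum.swap_restrict[OF fin t_design_finite_blocks[OF D]])
  also have "\<dots> = (\<Sum>A\<in>Bs. \<Sum>a\<in>A. f (A - {a}))"
  proof (rule sum.cong[OF refl])
    fix A assume "A \<in> Bs"
    note A = t_design_block[OF D this]
    have "{T \<in> ?\<T>. T \<subseteq> A} = (\<lambda>a. A - {a}) ` A"
    proof (intro equalityI subsetI)
      fix T assume T: "T \<in> {T \<in> ?\<T>. T \<subseteq> A}"
      then have "card (A - T) = 1"
        using A finite_subset[of T A] by (simp add: card_Diff_subset)
      then obtain a where "A - T = {a}"
        by (auto simp: card_1_singleton_iff)
      then have "a \<in> A" "T = A - {a}" using T by auto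
      then show "T \<in> (\<lambda>a. A - {a}) ` A" by blast
    qed (use A in auto)
    moreover have "inj_on (\<lambda>a. A - {a}) A"
      by (auto simp: inj_on_def)
    ultimately show "(\<Sum>T | T \<in> ?\<T> \<and> T \<subseteq> A. f T) = (\<Sum>a\<in>A. f (A - {a}))"
      by (simp add: sum.reindex)
  qed
  finally show ?thesis .
qed

text \<open>
  A bijection from \<open>B\<close> to \<open>P - B\<close> extends to an involution of \<open>P\<close> that exchanges the two halves.
  It permutes the \<open>t\<close>-subsets and turns \<open>card (T \<inter> B) = i\<close> into \<open>card (T \<inter> B) = t - i\<close>.
\<close>

lemma sum_halving_antisymmetric:
  fixes w :: "nat \<Rightarrow> real"
  assumes "finite P" "B \<subseteq> P" and half: "card (P - B) = card B"
    and anti: "\<And>i. i \<le> t \<Longrightarrow> w (t - i) = - w i"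
  shows "(\<Sum>T | T \<subseteq> P \<and> card T = t. w (card (T \<inter> B))) = 0"
proof -
  let ?\<T> = "{T. T \<subseteq> P \<and> card T = t}"
  have fin: "finite B" "finite (P - B)"
    using \<open>finite P\<close> finite_subset[OF \<open>B \<subseteq> P\<close>] by simp_all
  obtain h where h: "bij_betw h B (P - B)"
    using finite_same_card_bij[OF fin] half by auto
  define \<sigma> where "\<sigma> x = (if x \<in> B then h x else inv_into B h x)" for x
  have hB: "h x \<in> P - B" "inv_into B h (h x) = x" if "x \<in> B" for x
    using that h by (auto simp: bij_betw_def)
  have hC: "inv_into B h x \<in> B" "h (inv_into B h x) = x" if "x \<in> P - B" for x
    using that h by (auto simp: bij_betw_def inv_into_into f_inv_into_f)
  have \<sigma>\<sigma>: "\<sigma> (\<sigma> x) = x" and \<sigma>P: "\<sigma> x \<in> P" and \<sigma>B: "\<sigma> x \<in> B \<longleftrightarrow> x \<notin> B" if "x \<in> P" for x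
    using that hB[of x] hC[of x] \<open>B \<subseteq> P\<close> unfolding \<sigma>_def by auto
  have inj: "inj_on \<sigma> P"
    by (metis \<sigma>\<sigma> inj_onI)
  have image\<T>: "\<sigma> ` T \<in> ?\<T>" if "T \<in> ?\<T>" for T
    using that \<sigma>P card_image[OF inj_on_subset[OF inj]] by auto
  have twice: "\<sigma> ` \<sigma> ` T = T" if "T \<in> ?\<T>" for T
  proof -
    have "(\<lambda>x. \<sigma> (\<sigma> x)) ` T = (\<lambda>x. x) ` T"
      using that \<sigma>\<sigma> by (intro image_cong) auto
    then show ?thesis by (simp add: image_image)
  qed
  have "(\<Sum>T\<in>?\<T>. w (card (T \<inter> B))) = (\<Sum>T\<in>?\<T>. - w (card (T \<inter> B)))"
  proof (rule sum.reindex_bij_witness[where i = "image \<sigma>" and j = "image \<sigma>"])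
    fix T assume T: "T \<in> ?\<T>"
    then have finT: "finite T"
      using \<open>finite P\<close> finite_subset[of T P] by simp
    have "\<sigma> ` T \<inter> B = \<sigma> ` (T - B)"
      using T \<sigma>B by auto
    then have "card (\<sigma> ` T \<inter> B) = card (T - B)"
      using T card_image[OF inj_on_subset[OF inj], of "T - B"] by auto
    also have "\<dots> = t - card (T \<inter> B)"
      using T finT by (simp add: card_Diff_subset_Int)
    finally have "w (card (\<sigma> ` T \<inter> B)) = - w (card (T \<inter> B))"
      using anti[of "card (T \<inter> B)"] T finT card_mono[of T "T \<inter> B"] by auto
    then show "- w (card (\<sigma> ` T \<inter> B)) = w (card (T \<inter> B))" by simp
  qed (use image\<T> twice in auto)
  then show ?thesis
    by (simp add: sum_negf)
qed

section \<open>The alternating weight\<close>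

text \<open>
  Up to a scalar, this is the only solution of the cancellation recurrence
  \<open>i * w (i - 1) + (t + 1 - i) * w i = 0\<close> for \<open>0 < i \<le> t\<close>.
\<close>

definition alternating_weight :: "nat \<Rightarrow> nat \<Rightarrow> real" where
  "alternating_weight t i = (- 1) ^ i / real (t choose i)"

lemma alternating_weight_nonzero:
  "i \<le> t \<Longrightarrow> alternating_weight t i \<noteq> 0"
  by (simp add: alternating_weight_def)

lemma alternating_weight_antisymmetric:
  assumes "odd t" and "i \<le> t"
  shows "alternating_weight t (t - i) = - alternating_weight t i"
proof -
  have "(- 1 :: real) ^ (t - i) = - ((- 1) ^ i)"
    using assms by (cases "even i") auto
  then show ?thesis
    using binomial_symmetric[OF \<open>i \<le> t\<close>] by (simp add: alternating_weight_def)
qed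

lemma alternating_weight_cancel:
  assumes "0 < i" and "i \<le> t"
  shows "real i * alternating_weight t (i - 1) + real (Suc t - i) * alternating_weight t i = 0"
proof -
  obtain j where i: "i = Suc j"
    using \<open>0 < i\<close> gr0_implies_Suc by blast
  have "Suc j * (t choose Suc j) = (t - j) * (t choose j)"
    using binomial_absorb_comp[of t j] binomial_absorption[of j t] by simp
  then have "real (Suc j) * real (t choose Suc j) = real (t - j) * real (t choose j)"
    by (metis of_nat_mult)
  moreover have "real (t choose Suc j) \<noteq> 0" "real (t choose j) \<noteq> 0"
    using assms i by auto
  ultimately have "real (Suc j) / real (t choose j) = real (t - j) / real (t choose Suc j)"
    by (simp add: frac_eq_eq mult.commute)
  moreover have "real i * alternating_weight t (i - 1) + real (Suc t - i) * alternating_weight t i =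
      (- 1) ^ j * (real (Suc j) / real (t choose j) - real (t - j) / real (t choose Suc j))"
    unfolding i alternating_weight_def by (simp add: right_diff_distrib mult.commute)
  ultimately show ?thesis by simp
qed

section \<open>Complements of blocks\<close>

text \<open>Removing a point of \<open>A\<close> lowers the intersection with \<open>B\<close> exactly if the point lies in \<open>B\<close>.\<close>

lemma sum_delete_point_inter:
  fixes w :: "nat \<Rightarrow> real"
  assumes "finite A"
  shows "(\<Sum>a\<in>A. w (card ((A - {a}) \<inter> B))) =
    real (card (A \<inter> B)) * w (card (A \<inter> B) - 1) + real (card A - card (A \<inter> B)) * w (card (A \<inter> B))"
proof -
  let ?f = "\<lambda>a. w (card ((A - {a}) \<inter> B))"
  have "sum ?f A = sum ?f (A \<inter> B) + sum ?f (A - B)"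
    using sum.Int_Diff[OF assms] .
  also have "sum ?f (A \<inter> B) = (\<Sum>a\<in>A \<inter> B. w (card (A \<inter> B) - 1))"
    using assms by (intro sum.cong refl) (simp add: Diff_Int_distrib2 card_Diff_singleton)
  also have "sum ?f (A - B) = (\<Sum>a\<in>A - B. w (card (A \<inter> B)))"
  proof (intro sum.cong refl)
    fix a assume "a \<in> A - B"
    then have "(A - {a}) \<inter> B = A \<inter> B" by blast
    then show "?f a = w (card (A \<inter> B))" by simp
  qed
  finally show ?thesis
    using assms by (simp add: card_Diff_subset_Int)
qed

lemma complement_of_block:
  assumes D: "t_design t (2 * Suc t) (Suc t) 1 (P, Bs)" and B: "B \<in> Bs"
  shows "P - B \<in> Bs"
proof (rule ccontr)
  assume no_complement: "P - B \<notin> Bs"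
  note P = t_design_finite_points[OF D] and blockB = t_design_block[OF D B]
  let ?w = "alternating_weight t"
  let ?s = "\<lambda>A. \<Sum>a\<in>A. ?w (card ((A - {a}) \<inter> B))"
  have half: "card (P - B) = card B"
    using blockB P by (simp add: card_Diff_subset)
  have "odd t"
    using t_design_parity[OF D] by auto
  have others: "?s A = 0" if A: "A \<in> Bs - {B}" for A
  proof -
    have "A \<in> Bs" using A by simp
    note blockA = t_design_block[OF D this]
    have "A \<inter> B \<noteq> {}"
    proof
      assume "A \<inter> B = {}"
      then have "A \<subseteq> P - B" using blockA by blast
      then have "A = P - B"
        using card_subset_eq[of "P - B" A] P half blockA blockB by simp
      then show False using A no_complement by simp
    qed
    moreover have "A \<inter> B \<subset> A"
    proof -
      have "\<not> A \<subseteq> B"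
        using card_subset_eq[of B A] blockA blockB A by auto
      then show ?thesis by blast
    qed
    ultimately have "0 < card (A \<inter> B)" "card (A \<inter> B) \<le> t"
      using blockA psubset_card_mono[of A "A \<inter> B"] by (auto simp: card_gt_0_iff)
    then show ?thesis
      using alternating_weight_cancel sum_delete_point_inter[OF blockA(3)] blockA(2) by simp
  qed
  have "?s B = (\<Sum>A\<in>Bs. ?s A)"
    using sum.remove[OF t_design_finite_blocks[OF D] B, of ?s] others by simp
  also have "\<dots> = (\<Sum>T | T \<subseteq> P \<and> card T = t. ?w (card (T \<inter> B)))"
    using sum_t_subsets_by_block[OF D, of "\<lambda>T. ?w (card (T \<inter> B))"] by simp
  also have "\<dots> = 0"
    using sum_halving_antisymmetric[OF P(1) blockB(1) half]
      alternating_weight_antisymmetric[OF \<open>odd t\<close>] by blast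
  finally have "real (Suc t) * ?w t = 0"
    using sum_delete_point_inter[OF blockB(3), of ?w B] blockB(2) by simp
  then show False
    using alternating_weight_nonzero[of t t] by simp
qed

theorem corollary33:
  fixes n :: nat and P :: "'a set" and Bs :: "'a set set"
  assumes "n \<ge> 4" and "even n"
    and "t_design ((n - 2) div 2) n (n div 2) 1 (P, Bs)"
  shows "(\<forall>B\<in>Bs. P - B \<in> Bs) \<and> complementary_design (P, Bs) = (P, Bs)"
proof -
  define t where "t = (n - 2) div 2"
  have "n div 2 = Suc t" "n = 2 * Suc t"
    using assms(1,2) unfolding t_def by auto
  then have D: "t_design t (2 * Suc t) (Suc t) 1 (P, Bs)"
    using assms(3) t_def by metis
  have closed: "P - B \<in> Bs" if "B \<in> Bs" for B
    using complement_of_block[OF D that] .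
  have involution: "P - (P - B) = B" if "B \<in> Bs" for B
    using t_design_block(1)[OF D that] by blast
  have "{P - B | B. B \<in> Bs} = Bs"
  proof (intro equalityI subsetI)
    fix B assume "B \<in> Bs"
    then show "B \<in> {P - B | B. B \<in> Bs}"
      using closed involution[symmetric] by blast
  qed (use closed in auto)
  then show ?thesis
    using closed by (simp add: complementary_design_def)
qed

end
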